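(* Let $\mu$ be an ultra-log-concave probability measure over $\mathbb N$. Let $\mathcal I\subseteq\mathbb R$ be a closed interval, not necessarily bounded, and let $\Phi:\mathcal I\to\mathbb R$ be a smooth convex function. Suppose that the function $$\{(u,v)\in\mathbb R^2:(u,u+v)\in\mathcal I\times\mathcal I\}\ni(u,v)\ \mapsto\ \Psi(u,v):=\Phi(u+v)-\Phi(u)-\Phi'(u)v$$ is nonnegative and convex. Then, for any $g\in L^2(\mathbb N,\mu)$ such that $\mu$-a.s. $g,\,g+Dg\in\mathcal I$, $$\mathrm{Ent}^\Phi_\mu(g)\le|\log\mu(0)|\;\mathbb E_\mu[\Psi(g,Dg)].$$
   Context: $\mathbb N=\{0,1,2,\dots\}$. For $\lambda>0$, $\pi_\lambda(k)=e^{-\lambda}\lambda^k/k!$ is the Poisson measure on $\mathbb N$. A function $f:\mathbb N\to(0,\infty)$ is log-concave if $f(k)^2\ge f(k-1)f(k+1)$ for all integers $k\ge1$. A probability measure $\mu$ on $\mathbb N$ is ultra-log-concave if $\mu(k)=f(k)\pi_\lambda(k)$ for all $k\in\mathbb N$, for some $\lambda>0$ and some positive log-concave $f:\mathbb N\to(0,\infty)$. For $g:\mathbb N\to\mathbb R$, $Dg(k):=g(k+1)-g(k)$. For a $\mu$-integrable $g$ with values in $\mathcal I$, the $\Phi$-entropy is $\mathrm{Ent}^\Phi_\mu(g):=\int\Phi(g)\,d\mu-\Phi\left(\int g\,d\mu\right)$. *)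

theory Defs
  imports "HOL-Probability.Probability"
begin

definition log_concave :: "(nat \<Rightarrow> real) \<Rightarrow> bool" where
  "log_concave f \<longleftrightarrow> (\<forall>k\<ge>1. (f k)\<^sup>2 \<ge> f (k - 1) * f (k + 1))"

definition ultra_log_concave :: "nat pmf \<Rightarrow> bool" where
  "ultra_log_concave \<mu> \<longleftrightarrow>
     (\<exists>l>0. \<exists>f. (\<forall>k. f k > 0) \<and> log_concave f \<and>
        (\<forall>k. pmf \<mu> k = f k * pmf (poisson_pmf l) k))"

definition fdiff :: "(nat \<Rightarrow> real) \<Rightarrow> nat \<Rightarrow> real" where
  "fdiff g k = g (k + 1) - g k"

text \<open>Smoothness on a closed interval: derivatives of all orders exist relative to the interval,
  hence as one-sided derivatives at endpoints. The function \<open>d n\<close> is the \<open>n\<close>-th derivative.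
  Values outside \<open>I\<close> are irrelevant.\<close>

definition smooth_on_interval :: "real set \<Rightarrow> (real \<Rightarrow> real) \<Rightarrow> bool" where
  "smooth_on_interval I \<Phi> \<longleftrightarrow>
     (\<exists>d :: nat \<Rightarrow> real \<Rightarrow> real. (\<forall>x\<in>I. d 0 x = \<Phi> x) \<and>
        (\<forall>n. \<forall>x\<in>I. (d n has_real_derivative d (Suc n) x) (at x within I)))"

text \<open>The derivative in \<open>Psi\<close> is also relative to \<open>I\<close>. If \<open>I\<close> is a single point it is an
  unspecified number, but then \<open>v = 0\<close> on \<open>Psi_dom I\<close>.\<close>

definition Psi_dom :: "real set \<Rightarrow> (real \<times> real) set" where
  "Psi_dom I = {(u, v). u \<in> I \<and> u + v \<in> I}"

definition Psi :: "real set \<Rightarrow> (real \<Rightarrow> real) \<Rightarrow> real \<times> real \<Rightarrow> real" where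
  "Psi I \<Phi> = (\<lambda>(u, v). \<Phi> (u + v) - \<Phi> u - vector_derivative \<Phi> (at u within I) * v)"

text \<open>The integral with values in the extended reals, used because \<open>\<Phi> \<circ> g\<close> and
  \<open>\<Psi>(g, Dg)\<close> need not be integrable, whereas the Bochner integral would then be \<open>0\<close>.
  The convention for \<open>\<infinity> - \<infinity>\<close> is immaterial for functions whose negative part is integrable;
  this holds for \<open>\<Phi> \<circ> g\<close> with \<open>\<Phi>\<close> convex and \<open>g\<close> integrable, as \<open>\<Phi>\<close> has an affine
  minorant.\<close>

definition ext_integral :: "'a measure \<Rightarrow> ('a \<Rightarrow> real) \<Rightarrow> ereal" where
  "ext_integral M f =
     enn2ereal (\<integral>\<^sup>+x. ennreal (f x) \<partial>M) - enn2ereal (\<integral>\<^sup>+x. ennreal (- f x) \<partial>M)"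

lemma ext_integral_eq_lebesgue_integral:
  assumes "integrable M f"
  shows "ext_integral M f = ereal (\<integral>x. f x \<partial>M)"
proof -
  have "(\<integral>\<^sup>+x. ennreal (f x) \<partial>M) < \<infinity>" "(\<integral>\<^sup>+x. ennreal (- f x) \<partial>M) < \<infinity>"
    using assms by (simp_all add: real_integrable_def less_top)
  then show ?thesis
    unfolding ext_integral_def real_lebesgue_integral_def[OF assms]
    by (cases "\<integral>\<^sup>+x. ennreal (f x) \<partial>M"; cases "\<integral>\<^sup>+x. ennreal (- f x) \<partial>M") auto
qed

definition Phi_entropy :: "'a measure \<Rightarrow> (real \<Rightarrow> real) \<Rightarrow> ('a \<Rightarrow> real) \<Rightarrow> ereal" where
  "Phi_entropy M \<Phi> g = ext_integral M (\<lambda>x. \<Phi> (g x)) - ereal (\<Phi> (\<integral>x. g x \<partial>M))"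

end

(* Restrict the measure to {0..N} and write its k-th weight as a k / k!, so that a is log-concave.
   Let F_x be the x-th derivative of F(s) = (\<Sum>k. a k * s^k / k!), and let G_x(s) be the mean of g
   under the probability with weights a (x + z) * s^z / z! / F_x(s) at x + z. The entropy
   functional E(s) = (\<Sum>x. F_x(s) * (1 - s)^x / x! * \<Phi> (G_x(s))) equals \<Phi> of the mean of g at s = 1
   and the mean of \<Phi> o g at s = 0, and
     E'(s) = - (\<Sum>x. F_(x+1)(s) * (1 - s)^x / x! * \<Psi>(G_x(s), G_(x+1)(s) - G_x(s))).
   In probabilistic terms, this follows the time reversal of the birth process of the Poisson
   transport map: 1 - s is time, F_x(s) * (1 - s)^x / x! is its law, F_(x+1)(s) / F_x(s) its jump rate.
   Log-concavity makes the jump rates decrease in x and allows the conditional laws at x and x + 1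
   to be coupled with an increment in {0, 1}, so that Jensen's inequality for \<Psi> gives
     - E'(s) \<le> F'(s) / F(s) * (mean of \<Psi>(g, Dg)).
   Hence E + ln F * (mean of \<Psi>(g, Dg)) is nondecreasing on [0, 1]. The general case is the
   limit as N tends to infinity. *)

theory Submission imports Defs
begin

section \<open>Exponential generating functions and comparison of partial sums\<close>

text \<open>If \<open>c\<close> vanishes beyond \<open>N\<close>, this is the \<open>x\<close>-th
  derivative of the polynomial with coefficients \<open>c k / fact k\<close>. The range of
  \<open>z\<close> is the same for all \<open>x\<close>; the terms with \<open>x + z > N\<close> are
  then zero.\<close>

definition egf :: "nat \<Rightarrow> (nat \<Rightarrow> real) \<Rightarrow> nat \<Rightarrow> real \<Rightarrow> real" where
  "egf N c x s = (\<Sum>z\<le>N. c (x + z) * s ^ z / fact z)"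

text \<open>Abel summation. The boundary term disappears when \<open>d\<close> is a difference of
  two probability vectors.\<close>

lemma sum_mult_diff_partial_sums:
  fixes d g :: "nat \<Rightarrow> real"
  shows "(\<Sum>k\<le>n. d k * g k) = (\<Sum>k\<le>n. d k) * g (Suc n) - (\<Sum>k\<le>n. (\<Sum>j\<le>k. d j) * (g (Suc k) - g k))"
  by (induction n) (simp_all add: algebra_simps)

text \<open>Likelihood ratio order implies stochastic order. The products with both indices at most
  \<open>k\<close> cancel, and the remaining pairs satisfy \<open>i \<le> k < j\<close>, where
  \<open>cross\<close> applies termwise.\<close>

lemma partial_sum_ratio_mono:
  fixes p q :: "nat \<Rightarrow> real"
  assumes cross: "\<And>i j. i \<le> j \<Longrightarrow> j \<le> n \<Longrightarrow> q i * p j \<le> p i * q j" and "k \<le> n"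
  shows "(\<Sum>i\<le>k. q i) * (\<Sum>j\<le>n. p j) \<le> (\<Sum>i\<le>k. p i) * (\<Sum>j\<le>n. q j)"
proof -
  have split: "(\<Sum>j\<le>n. h j) = (\<Sum>j\<le>k. h j) + (\<Sum>j\<in>{k<..n}. h j)" for h :: "nat \<Rightarrow> real"
  proof -
    have "{..n} = {..k} \<union> {k<..n}" using \<open>k \<le> n\<close> by auto
    then show ?thesis by (simp add: sum.union_disjoint disjoint_iff)
  qed
  have "(\<Sum>i\<le>k. q i) * (\<Sum>j\<in>{k<..n}. p j) \<le> (\<Sum>i\<le>k. p i) * (\<Sum>j\<in>{k<..n}. q j)"
    unfolding sum_product by (intro sum_mono cross) auto
  then show ?thesis unfolding split by (simp add: algebra_simps)
qed

text \<open>The ratios of consecutive values decrease. The inequality is kept in product form so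
  that it still makes sense after truncation, when some weights are zero.\<close>

lemma log_concave_cross:
  assumes pos: "\<And>k. 0 < f k" and "log_concave f" and "i \<le> j"
  shows "f i * f (Suc j) \<le> f j * f (Suc i)"
  using \<open>i \<le> j\<close>
proof (induction j rule: dec_induct)
  case (step j)
  have "f j * f (Suc (Suc j)) \<le> f (Suc j) * f (Suc j)"
    using \<open>log_concave f\<close>[unfolded log_concave_def, rule_format, of "Suc j"] by (simp add: power2_eq_square)
  from mult_left_mono[OF this less_imp_le[OF pos[of i]]] mult_right_mono[OF step.IH less_imp_le[OF pos[of "Suc j"]]]
  have "f j * (f i * f (Suc (Suc j))) \<le> f j * (f (Suc j) * f (Suc i))"
    by (simp add: algebra_simps)
  then show ?case using pos[of j] by simp
qed simp

text \<open>Reindexes a termwise derivative: the term \<open>z = 0\<close> vanishes on the left, and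
  the hypothesis removes the extra top term on the right. It serves both for derivatives in
  \<open>s\<close> of \<open>egf\<close> and for summation by parts over the state
  \<open>x\<close>.\<close>

lemma sum_power_deriv_shift:
  fixes h :: "nat \<Rightarrow> real"
  assumes "h (Suc N) = 0"
  shows "(\<Sum>z\<le>N. h z * (real z * s ^ (z - 1)) / fact z) = (\<Sum>z\<le>N. h (Suc z) * s ^ z / fact z)"
proof -
  have "(\<Sum>z\<le>N. h z * (real z * s ^ (z - 1)) / fact z) = (\<Sum>z<Suc N. h z * (real z * s ^ (z - 1)) / fact z)"
    by (simp add: lessThan_Suc_atMost)
  also have "\<dots> = (\<Sum>z<N. h (Suc z) * s ^ z / fact z)"
    unfolding sum.lessThan_Suc_shift by (auto intro!: sum.cong simp: field_simps simp del: of_nat_Suc)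
  also have "\<dots> = (\<Sum>z\<le>N. h (Suc z) * s ^ z / fact z)"
    unfolding lessThan_Suc_atMost[symmetric] using assms by simp
  finally show ?thesis .
qed

lemma egf_Suc:
  assumes "\<And>k. N < k \<Longrightarrow> c k = 0"
  shows "egf N c (Suc x) s = (\<Sum>z\<le>N. c (x + z) * (real z * s ^ (z - 1)) / fact z)"
  using sum_power_deriv_shift[of "\<lambda>z. c (x + z)" N s] assms by (simp add: egf_def)

lemma egf_has_derivative:
  assumes "\<And>k. N < k \<Longrightarrow> c k = 0"
  shows "(egf N c x has_real_derivative egf N c (Suc x) s) (at s within A)"
proof -
  have "egf N c (Suc x) s = (\<Sum>z\<le>N. c (x + z) * (real z * s ^ (z - 1)) / fact z)"
    by (rule egf_Suc) (rule assms)
  then show ?thesis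
    unfolding egf_def[abs_def] by (auto intro!: derivative_eq_intros simp: mult_ac)
qed

text \<open>Taylor's formula for a polynomial, from \<open>s\<close> to 1. Grouping by
  \<open>k = x + z\<close> leaves the binomial expansion of
  \<open>((1 - s) + s) ^ k\<close>.\<close>

lemma egf_taylor:
  assumes z: "\<And>k. N < k \<Longrightarrow> c k = 0"
  shows "(\<Sum>x\<le>N. egf N c x s * (1 - s) ^ x / fact x) = (\<Sum>k\<le>N. c k / fact k)"
proof -
  let ?h = "\<lambda>x z. c (x + z) * s ^ z / fact z * (1 - s) ^ x / fact x"
  have "(\<Sum>x\<le>N. egf N c x s * (1 - s) ^ x / fact x) = (\<Sum>x\<le>N. \<Sum>z\<le>N. ?h x z)"
    by (simp add: egf_def sum_distrib_right sum_divide_distrib)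
  also have "\<dots> = (\<Sum>(x,z)\<in>{..N} \<times> {..N}. ?h x z)"
    by (simp add: sum.cartesian_product)
  also have "\<dots> = (\<Sum>(x,z)\<in>{(x,z). x + z \<le> N}. ?h x z)"
    by (rule sum.mono_neutral_right) (auto intro!: z)
  also have "\<dots> = (\<Sum>k\<le>N. \<Sum>x\<le>k. ?h x (k - x))"
    by (rule sum.triangle_reindex_eq)
  also have "\<dots> = (\<Sum>k\<le>N. c k / fact k)"
  proof (rule sum.cong[OF refl])
    fix k
    have "(\<Sum>x\<le>k. ?h x (k - x)) = (\<Sum>x\<le>k. c k / fact k * (of_nat (k choose x) * (1 - s) ^ x * s ^ (k - x)))"
      by (intro sum.cong) (auto simp: binomial_fact field_simps)
    also have "\<dots> = c k / fact k * ((1 - s) + s) ^ k"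
      by (simp only: binomial_ring sum_distrib_left)
    finally show "(\<Sum>x\<le>k. ?h x (k - x)) = c k / fact k" by simp
  qed
  finally show ?thesis .
qed


section \<open>Conditional laws, their coupling, and Jensen's inequality\<close>

locale log_concave_weights =
  fixes N :: nat and a :: "nat \<Rightarrow> real"
  assumes pos: "k \<le> N \<Longrightarrow> 0 < a k"
    and zero: "N < k \<Longrightarrow> a k = 0"
    and cross: "i \<le> j \<Longrightarrow> a i * a (Suc j) \<le> a j * a (Suc i)"
begin

lemma nonneg: "0 \<le> a k"
  using pos[of k] zero[of k] by (cases "k \<le> N") auto

lemma egf_pos:
  assumes "x \<le> N" "0 \<le> s"
  shows "0 < egf N a x s"
proof -
  have "0 < a (x + 0) * s ^ 0 / fact 0" using pos[OF \<open>x \<le> N\<close>] by simp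
  also have "\<dots> \<le> egf N a x s"
    unfolding egf_def using assms nonneg by (intro member_le_sum) auto
  finally show ?thesis .
qed

text \<open>This is G_x(s). For \<open>x > N\<close> it is 0/0, hence 0; the derivative formula at
  \<open>x = N\<close> mentions such a value, but with the factor
  \<open>egf N a (Suc N) s = 0\<close>.\<close>

definition cmean :: "(nat \<Rightarrow> real) \<Rightarrow> nat \<Rightarrow> real \<Rightarrow> real" where
  "cmean g x s = egf N (\<lambda>k. a k * g k) x s / egf N a x s"

definition cprob :: "nat \<Rightarrow> real \<Rightarrow> nat \<Rightarrow> real" where
  "cprob x s z = a (x + z) * s ^ z / fact z / egf N a x s"

lemma cprob_nonneg: "x \<le> N \<Longrightarrow> 0 \<le> s \<Longrightarrow> 0 \<le> cprob x s z"
  using egf_pos[of x s] nonneg[of "x + z"] by (simp add: cprob_def)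

lemma sum_cprob: "x \<le> N \<Longrightarrow> 0 \<le> s \<Longrightarrow> (\<Sum>z\<le>N. cprob x s z) = 1"
  unfolding cprob_def sum_divide_distrib[symmetric] egf_def[symmetric]
  using egf_pos[of x s] by simp

lemma cmean_eq_sum: "cmean g x s = (\<Sum>z\<le>N. cprob x s z * g (x + z))"
  by (simp add: cmean_def cprob_def egf_def sum_divide_distrib mult_ac)

lemma cmean_in:
  assumes "convex S" "\<And>k. g k \<in> S" "x \<le> N" "0 \<le> s"
  shows "cmean g x s \<in> S"
  using convex_sum[OF _ assms(1) sum_cprob cprob_nonneg, of x s "\<lambda>z. g (x + z)"] assms
  by (simp add: cmean_eq_sum)

text \<open>Here \<open>\<theta> z\<close> is the conditional probability of a unit increment, given the value \<open>x + z\<close>, in the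
  coupling of the conditional laws at \<open>x\<close> and \<open>x + 1\<close>. The laws are comparable in likelihood
  ratio, hence so are their distribution functions, whose difference is \<open>t\<close> below.\<close>

lemma monotone_coupling:
  assumes "x < N" "0 < s"
  obtains \<theta> where "\<And>z. 0 \<le> \<theta> z" "\<And>z. \<theta> z \<le> 1"
    "\<And>g. cmean g (Suc x) s - cmean g x s
        = (\<Sum>z\<le>N. cprob x s z * (\<theta> z * (g (Suc (x + z)) - g (x + z))))"
proof -
  define P where "P = egf N a x s"
  define Q where "Q = egf N a (Suc x) s"
  have PQ: "0 < P" "0 < Q" using egf_pos assms by (auto simp: P_def Q_def)
  let ?p = "cprob x s"
  \<comment> \<open>The conditional law at \<open>Suc x\<close>, with positions counted from
    \<open>x\<close> like those of \<open>cprob x s\<close>. Thus \<open>q 0 = 0\<close>, and both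
    laws live on the points \<open>x + z\<close>.\<close>
  define q where "q z = a (x + z) * (real z * s ^ (z - 1)) / fact z / Q" for z
  have q_alt: "q z = a (x + z) * s ^ z / fact z * real z / s / Q" for z
    using \<open>0 < s\<close> by (cases z) (simp_all add: q_def)
  have q_Suc: "q (Suc z) = a (Suc x + z) * s ^ z / fact z / Q" for z
    using PQ by (simp add: q_def field_simps del: of_nat_Suc)
  have mean_q: "cmean g (Suc x) s = (\<Sum>z\<le>N. q z * g (x + z))" for g
    unfolding cmean_def Q_def[symmetric]
    by (subst egf_Suc) (auto simp: zero q_def sum_divide_distrib mult_ac intro!: sum.cong)
  have sum_q: "(\<Sum>z\<le>N. q z) = 1"
    using mean_q[of "\<lambda>_. 1"] PQ by (simp add: cmean_def Q_def)
  have sum_r: "(\<Sum>z\<le>N. q (Suc z)) = 1"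
    unfolding q_Suc sum_divide_distrib[symmetric] egf_def[symmetric] Q_def[symmetric]
    using PQ by simp
  have sum_p: "(\<Sum>z\<le>N. ?p z) = 1" using sum_cprob assms by simp
  define t where "t z = (\<Sum>j\<le>z. ?p j - q j)" for z
  have t_nonneg: "0 \<le> t z" if "z \<le> N" for z
  proof -
    \<comment> \<open>\<open>q z\<close> is \<open>?p z\<close> times a constant multiple of
      \<open>z\<close>, so the likelihood ratio increases.\<close>
    have "q i * ?p j \<le> ?p i * q j" if "i \<le> j" "j \<le> N" for i j
    proof -
      have "(a (x + i) * s ^ i / fact i * (a (x + j) * s ^ j / fact j) / s / Q / P) * real i
          \<le> (a (x + i) * s ^ i / fact i * (a (x + j) * s ^ j / fact j) / s / Q / P) * real j"
        using that nonneg PQ \<open>0 < s\<close> by (intro mult_left_mono) auto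
      then show ?thesis by (simp add: q_alt cprob_def P_def[symmetric] mult_ac)
    qed
    from partial_sum_ratio_mono[where q = q and p = ?p and n = N and k = z, OF this \<open>z \<le> N\<close>]
    show ?thesis by (simp add: t_def sum_subtractf sum_p sum_q)
  qed
  have t_le: "t z \<le> ?p z" if "z \<le> N" for z
  proof (cases z)
    case 0
    then show ?thesis by (simp add: t_def q_def)
  next
    case (Suc m)
    \<comment> \<open>Log-concavity enters here: after moving \<open>q\<close> back by one, its
      ratio to \<open>?p\<close> is proportional to \<open>a (Suc (x + z)) / a (x + z)\<close>,
      which decreases. So the law at \<open>Suc x\<close> lies below the law at \<open>x\<close>
      shifted up by one.\<close>
    have "?p i * q (Suc j) \<le> q (Suc i) * ?p j" if "i \<le> j" "j \<le> N" for i j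
    proof -
      have "(s ^ i / fact i * (s ^ j / fact j) / Q / P) * (a (x + i) * a (Suc (x + j)))
          \<le> (s ^ i / fact i * (s ^ j / fact j) / Q / P) * (a (x + j) * a (Suc (x + i)))"
        using that PQ \<open>0 < s\<close> by (intro mult_left_mono cross) auto
      then show ?thesis by (simp add: q_Suc cprob_def P_def[symmetric] mult_ac)
    qed
    from partial_sum_ratio_mono[where q = ?p and p = "\<lambda>j. q (Suc j)" and n = N and k = m, OF this]
    have "(\<Sum>j\<le>m. ?p j) \<le> (\<Sum>j\<le>m. q (Suc j))"
      using that Suc by (simp add: sum_p sum_r)
    also have "\<dots> = (\<Sum>j\<le>z. q j)"
      unfolding Suc sum.atMost_Suc_shift by (simp add: q_def)
    finally show ?thesis by (simp add: t_def sum_subtractf Suc)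
  qed
  \<comment> \<open>Where \<open>?p z = 0\<close>, the bounds on \<open>t\<close> force
    \<open>t z = 0\<close>, so the default value of the division is harmless.\<close>
  define \<theta> where "\<theta> z = (if z \<le> N then t z / ?p z else 0)" for z
  have p_theta: "?p z * \<theta> z = t z" if "z \<le> N" for z
    using t_nonneg[OF that] t_le[OF that] that by (cases "?p z = 0") (auto simp: \<theta>_def)
  show thesis
  proof
    show "0 \<le> \<theta> z" "\<theta> z \<le> 1" for z
      using t_nonneg[of z] t_le[of z] by (auto simp: \<theta>_def divide_le_eq_1)
    fix g
    \<comment> \<open>Abel summation; both laws have mass 1, so no boundary term remains.\<close>
    have "cmean g (Suc x) s - cmean g x s = - (\<Sum>z\<le>N. (?p z - q z) * g (x + z))"
      unfolding mean_q unfolding cmean_eq_sum by (simp add: algebra_simps sum_subtractf)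
    also have "\<dots> = (\<Sum>z\<le>N. t z * (g (Suc (x + z)) - g (x + z)))"
      unfolding sum_mult_diff_partial_sums[of _ "\<lambda>z. g (x + z)"] t_def
      by (simp add: sum_subtractf sum_p sum_q)
    also have "\<dots> = (\<Sum>z\<le>N. ?p z * (\<theta> z * (g (Suc (x + z)) - g (x + z))))"
      by (intro sum.cong) (auto simp flip: p_theta)
    finally show "cmean g (Suc x) s - cmean g x s
        = (\<Sum>z\<le>N. ?p z * (\<theta> z * (g (Suc (x + z)) - g (x + z))))" .
  qed
qed

text \<open>The jump rate at \<open>x\<close> is the conditional mean of
  \<open>r k = a (Suc k) / a k\<close>. Since \<open>r\<close> decreases and the coupling only moves
  upwards, this mean decreases in \<open>x\<close>.\<close>

lemma egf_ratio_le:
  assumes "x \<le> N" "0 < s"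
  shows "egf N a (Suc x) s / egf N a x s \<le> egf N a 1 s / egf N a 0 s"
proof -
  \<comment> \<open>Beyond \<open>N\<close> this is 0/0 = 0, so \<open>a k * r k = a (Suc k)\<close>
    holds for every \<open>k\<close>.\<close>
  define r where "r k = a (Suc k) / a k" for k
  have "a k * r k = a (Suc k)" for k
    using pos[of k] zero[of k] zero[of "Suc k"] by (cases "k \<le> N") (auto simp: r_def)
  then have ratio: "egf N a (Suc x) s / egf N a x s = cmean r x s" for x
    by (simp add: cmean_def egf_def)
  have r_le: "r (Suc k) \<le> r k" for k
  proof (cases "Suc k \<le> N")
    case True
    then show ?thesis using cross[of k "Suc k"] pos[of k] pos[of "Suc k"]
      by (simp add: r_def divide_simps mult_ac)
  qed (simp add: r_def zero nonneg)
  have step: "cmean r (Suc x) s \<le> cmean r x s" if x: "x < N" for x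
  proof -
    obtain \<theta> where \<theta>: "\<And>z. 0 \<le> \<theta> z"
      and eq: "cmean r (Suc x) s - cmean r x s
        = (\<Sum>z\<le>N. cprob x s z * (\<theta> z * (r (Suc (x + z)) - r (x + z))))"
      using monotone_coupling[OF x \<open>0 < s\<close>] by metis
    have "\<dots> \<le> 0"
      using \<theta> r_le cprob_nonneg x \<open>0 < s\<close>
      by (intro sum_nonpos mult_nonneg_nonpos) auto
    then show ?thesis using eq by simp
  qed
  have "cmean r x s \<le> cmean r 0 s" using \<open>x \<le> N\<close>
    by (induction x) (auto intro: order_trans[OF step])
  then show ?thesis using ratio[of 0] ratio[of x] by simp
qed

text \<open>The coupling writes the pair on the left as an average of the points \<open>y z\<close>,
  so Jensen's inequality applies to the jointly convex \<open>Psi\<close>. Each increment is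
  shortened by a factor in [0, 1]; convexity, nonnegativity and
  \<open>Psi I \<Phi> (u, 0) = 0\<close> show that shortening does not increase
  \<open>Psi\<close>.\<close>

lemma Psi_cmean_le:
  assumes "is_interval I" "\<And>k. g k \<in> I" "x < N" "0 < s"
    and Psi_nonneg: "\<And>p. p \<in> Psi_dom I \<Longrightarrow> 0 \<le> Psi I \<Phi> p"
    and conv: "convex_on (Psi_dom I) (Psi I \<Phi>)"
  shows "Psi I \<Phi> (cmean g x s, cmean g (Suc x) s - cmean g x s)
    \<le> cmean (\<lambda>k. Psi I \<Phi> (g k, g (Suc k) - g k)) x s"
proof -
  obtain \<theta> where \<theta>: "\<And>z. 0 \<le> \<theta> z" "\<And>z. \<theta> z \<le> 1"
    and eq: "cmean g (Suc x) s - cmean g x s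
      = (\<Sum>z\<le>N. cprob x s z * (\<theta> z * (g (Suc (x + z)) - g (x + z))))"
    using monotone_coupling[OF assms(3,4)] by metis
  define y where "y z = (g (x + z), \<theta> z * (g (Suc (x + z)) - g (x + z)))" for z
  have in_dom: "(g k, g (Suc k) - g k) \<in> Psi_dom I" "(g k, 0) \<in> Psi_dom I" for k
    using assms(2) by (auto simp: Psi_dom_def)
  have y_eq: "y z = (1 - \<theta> z) *\<^sub>R (g (x + z), 0) + \<theta> z *\<^sub>R (g (x + z), g (Suc (x + z)) - g (x + z))" for z
    by (simp add: y_def algebra_simps)
  have y_dom: "y z \<in> Psi_dom I" for z
    unfolding y_eq using convex_on_imp_convex[OF conv] in_dom \<theta> by (intro convexD) auto
  have y_le: "Psi I \<Phi> (y z) \<le> Psi I \<Phi> (g (x + z), g (Suc (x + z)) - g (x + z))" for z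
  proof -
    have "Psi I \<Phi> (y z) \<le> (1 - \<theta> z) * Psi I \<Phi> (g (x + z), 0)
        + \<theta> z * Psi I \<Phi> (g (x + z), g (Suc (x + z)) - g (x + z))"
      unfolding y_eq using in_dom \<theta> by (intro convex_onD[OF conv]) auto
    also have "Psi I \<Phi> (g (x + z), 0) = 0" by (simp add: Psi_def)
    also have "(1 - \<theta> z) * 0 + \<theta> z * Psi I \<Phi> (g (x + z), g (Suc (x + z)) - g (x + z))
        \<le> Psi I \<Phi> (g (x + z), g (Suc (x + z)) - g (x + z))"
      using mult_left_le_one_le[OF Psi_nonneg[OF in_dom(1)] \<theta>(1) \<theta>(2)] by simp
    finally show ?thesis .
  qed
  have "(cmean g x s, cmean g (Suc x) s - cmean g x s) = (\<Sum>z\<le>N. cprob x s z *\<^sub>R y z)"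
    unfolding eq unfolding cmean_eq_sum y_def by (auto simp: prod_eq_iff fst_sum snd_sum)
  then have "Psi I \<Phi> (cmean g x s, cmean g (Suc x) s - cmean g x s)
      \<le> (\<Sum>z\<le>N. cprob x s z * Psi I \<Phi> (y z))"
    using convex_on_sum[OF _ _ conv sum_cprob cprob_nonneg y_dom, of x s "\<lambda>z. z"] assms by simp
  also have "\<dots> \<le> cmean (\<lambda>k. Psi I \<Phi> (g k, g (Suc k) - g k)) x s"
    unfolding cmean_eq_sum using assms by (intro sum_mono mult_left_mono y_le cprob_nonneg) auto
  finally show ?thesis .
qed


section \<open>Monotonicity of the entropy functional in \<open>s\<close>\<close>

lemma egf_eq_0: "N < x \<Longrightarrow> egf N (\<lambda>k. a k * g k) x s = 0"
  by (simp add: egf_def zero)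

lemma egf_at_0: "egf N c x 0 = c x"
proof -
  have "egf N c x 0 = (\<Sum>z\<le>N. if z = 0 then c x else 0)"
    unfolding egf_def by (intro sum.cong) auto
  then show ?thesis by simp
qed

text \<open>The quotient rule, rearranged as jump rate times jump of the mean. At
  \<open>x = N\<close> both numerators vanish and the rate is zero.\<close>

lemma cmean_has_derivative:
  assumes "x \<le> N" "0 \<le> s"
  shows "(cmean g x has_real_derivative
    egf N a (Suc x) s / egf N a x s * (cmean g (Suc x) s - cmean g x s)) (at s within A)"
proof -
  let ?F = "\<lambda>x. egf N a x s" and ?H = "\<lambda>x. egf N (\<lambda>k. a k * g k) x s"
  have F: "?F x \<noteq> 0" using egf_pos assms by (metis less_irrefl)
  have "(cmean g x has_real_derivative (?H (Suc x) * ?F x - ?H x * ?F (Suc x)) / (?F x * ?F x)) (at s within A)"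
    unfolding cmean_def[abs_def] using F zero by (intro DERIV_divide egf_has_derivative) auto
  also have "(?H (Suc x) * ?F x - ?H x * ?F (Suc x)) / (?F x * ?F x)
      = ?F (Suc x) / ?F x * (?H (Suc x) / ?F (Suc x) - ?H x / ?F x)"
  proof (cases "Suc x \<le> N")
    case True
    then have "?F (Suc x) \<noteq> 0" using egf_pos assms by (metis less_irrefl)
    with F show ?thesis by (simp add: field_simps)
  next
    case False
    then have "?F (Suc x) = 0" "?H (Suc x) = 0"
      using egf_eq_0[of "Suc x" g] egf_eq_0[of "Suc x" "\<lambda>_. 1"] by auto
    then show ?thesis by simp
  qed
  finally show ?thesis unfolding cmean_def .
qed

lemma entropy_le:
  assumes I: "is_interval I" "\<And>k. g k \<in> I"
    and deriv: "\<And>u. u \<in> I \<Longrightarrow> (\<Phi> has_real_derivative vector_derivative \<Phi> (at u within I)) (at u within I)"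
    and Psi_nonneg: "\<And>p. p \<in> Psi_dom I \<Longrightarrow> 0 \<le> Psi I \<Phi> p"
    and conv: "convex_on (Psi_dom I) (Psi I \<Phi>)"
    and prob: "(\<Sum>k\<le>N. a k / fact k) = 1"
  shows "(\<Sum>k\<le>N. a k / fact k * \<Phi> (g k)) - \<Phi> (\<Sum>k\<le>N. a k / fact k * g k)
    \<le> - ln (a 0) * (\<Sum>k\<le>N. a k / fact k * Psi I \<Phi> (g k, g (Suc k) - g k))"
proof -
  define \<psi> where "\<psi> k = Psi I \<Phi> (g k, g (Suc k) - g k)" for k
  define B where "B = (\<Sum>k\<le>N. a k / fact k * \<psi> k)"
  define c where "c x s = (1 - s) ^ x / fact x" for x and s :: real
  define F where "F x s = egf N a x s" for x s
  define G where "G x s = cmean g x s" for x s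
  define E where "E s = (\<Sum>x\<le>N. F x s * c x s * \<Phi> (G x s))" for s
  define L where "L s = E s + ln (F 0 s) * B" for s
  have F_pos: "0 < F x s" if "x \<le> N" "0 \<le> s" for x s
    using egf_pos that by (simp add: F_def)
  have F_last: "F (Suc N) s = 0" for s
    using egf_eq_0[of "Suc N" "\<lambda>_. 1"] by (simp add: F_def)
  have c_nonneg: "0 \<le> c x s" if "s \<le> 1" for x s
    using that by (simp add: c_def)
  have G_in: "G x s \<in> I" if "x \<le> N" "0 \<le> s" for x s
    using cmean_in[OF is_interval_convex[OF I(1)] I(2) that] by (simp add: G_def)
  have \<psi>_nonneg: "0 \<le> \<psi> k" for k
    using I(2) unfolding \<psi>_def by (intro Psi_nonneg) (auto simp: Psi_dom_def)
  have E_deriv: "(E has_real_derivative - (\<Sum>x\<le>N. F (Suc x) s * c x s * Psi I \<Phi> (G x s, G (Suc x) s - G x s)))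
      (at s within {0..1})" if s: "s \<in> {0..1}" for s
  proof -
    let ?d = "\<lambda>x. vector_derivative \<Phi> (at (G x s) within I)"
    have Phi_G: "((\<lambda>s. \<Phi> (G x s)) has_real_derivative
        ?d x * (F (Suc x) s / F x s * (G (Suc x) s - G x s))) (at s within {0..1})" if "x \<le> N" for x
    proof -
      \<comment> \<open>G_x(s) may be an endpoint of \<open>I\<close>, so only a derivative relative
        to \<open>I\<close> is available; it is restricted to the image of the path before the chain
        rule is applied.\<close>
      have "(\<Phi> has_real_derivative ?d x) (at (G x s) within G x ` {0..1})"
        using that s by (intro DERIV_subset[OF deriv]) (auto intro: G_in)
      moreover have "(G x has_real_derivative F (Suc x) s / F x s * (G (Suc x) s - G x s)) (at s within {0..1})"
        using cmean_has_derivative[OF that, of s g] s by (simp add: G_def[abs_def] F_def)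
      ultimately show ?thesis
        by (rule DERIV_image_chain[unfolded o_def])
    qed
    have F_deriv: "(F x has_real_derivative F (Suc x) s) (at s within {0..1})" for x
      unfolding F_def[abs_def] using zero by (intro egf_has_derivative) auto
    have c_deriv: "(c x has_real_derivative - (real x * (1 - s) ^ (x - 1)) / fact x) (at s within {0..1})" for x
      unfolding c_def[abs_def] by (auto intro!: derivative_eq_intros)
    have "(E has_real_derivative (\<Sum>x\<le>N.
        (F (Suc x) s * c x s + - (real x * (1 - s) ^ (x - 1)) / fact x * F x s) * \<Phi> (G x s)
        + ?d x * (F (Suc x) s / F x s * (G (Suc x) s - G x s)) * (F x s * c x s))) (at s within {0..1})"
      unfolding E_def[abs_def]
      by (intro DERIV_sum DERIV_mult F_deriv c_deriv Phi_G) auto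
    also have "(\<Sum>x\<le>N.
        (F (Suc x) s * c x s + - (real x * (1 - s) ^ (x - 1)) / fact x * F x s) * \<Phi> (G x s)
        + ?d x * (F (Suc x) s / F x s * (G (Suc x) s - G x s)) * (F x s * c x s))
      = (\<Sum>x\<le>N. F (Suc x) s * c x s * (\<Phi> (G x s) + ?d x * (G (Suc x) s - G x s)))
        - (\<Sum>x\<le>N. F x s * \<Phi> (G x s) * (real x * (1 - s) ^ (x - 1)) / fact x)"
      unfolding sum_subtractf[symmetric]
    proof (intro sum.cong refl)
      fix x assume "x \<in> {..N}"
      then have "F x s \<noteq> 0" using F_pos[of x s] s by auto
      then show "(F (Suc x) s * c x s + - (real x * (1 - s) ^ (x - 1)) / fact x * F x s) * \<Phi> (G x s)
        + ?d x * (F (Suc x) s / F x s * (G (Suc x) s - G x s)) * (F x s * c x s)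
        = F (Suc x) s * c x s * (\<Phi> (G x s) + ?d x * (G (Suc x) s - G x s))
        - F x s * \<Phi> (G x s) * (real x * (1 - s) ^ (x - 1)) / fact x"
        by (simp add: field_simps)
    qed
    \<comment> \<open>Summation by parts in \<open>x\<close>: differentiating
      \<open>(1 - s) ^ x\<close> yields the values of \<open>\<Phi>\<close> after a jump. With the
      tangent terms of the other sum they combine into minus \<open>Psi\<close>.\<close>
    also have "(\<Sum>x\<le>N. F x s * \<Phi> (G x s) * (real x * (1 - s) ^ (x - 1)) / fact x)
        = (\<Sum>x\<le>N. F (Suc x) s * c x s * \<Phi> (G (Suc x) s))"
      by (subst sum_power_deriv_shift) (simp_all add: F_last c_def mult_ac)
    finally show ?thesis
      by (simp add: Psi_def algebra_simps flip: sum_subtractf sum_negf)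
  qed
  have L_deriv: "(L has_real_derivative
      - (\<Sum>x\<le>N. F (Suc x) s * c x s * Psi I \<Phi> (G x s, G (Suc x) s - G x s)) + F 1 s / F 0 s * B)
      (at s within {0..1})" if s: "s \<in> {0..1}" for s
  proof -
    have "(F 0 has_real_derivative F 1 s) (at s within {0..1})"
      unfolding F_def[abs_def] using egf_has_derivative[of N a 0] zero by simp
    from DERIV_chain2[OF DERIV_ln_divide[OF F_pos[of 0 s]] this] s
    have "((\<lambda>s. ln (F 0 s)) has_real_derivative F 1 s / F 0 s) (at s within {0..1})"
      by simp
    from DERIV_add[OF E_deriv[OF s] DERIV_cmult_right[OF this, of B]]
    show ?thesis unfolding L_def[abs_def] .
  qed
  have dissipation_le: "(\<Sum>x\<le>N. F (Suc x) s * c x s * Psi I \<Phi> (G x s, G (Suc x) s - G x s)) \<le> F 1 s / F 0 s * B"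
    if s: "0 < s" "s < 1" for s
  proof -
    let ?K = "\<lambda>x. egf N (\<lambda>k. a k * \<psi> k) x s"
    have K_nonneg: "0 \<le> ?K x" for x
      unfolding egf_def using nonneg \<psi>_nonneg s by (auto intro!: sum_nonneg)
    have "(\<Sum>x\<le>N. F (Suc x) s * c x s * Psi I \<Phi> (G x s, G (Suc x) s - G x s))
        \<le> (\<Sum>x\<le>N. F 1 s / F 0 s * (?K x * c x s))"
    proof (intro sum_mono)
      fix x assume "x \<in> {..N}"
      have Fx: "0 \<le> F x s" for x
        using F_pos[of x s] egf_eq_0[of x "\<lambda>_. 1"] s by (cases "x \<le> N") (auto simp: F_def)
      show "F (Suc x) s * c x s * Psi I \<Phi> (G x s, G (Suc x) s - G x s) \<le> F 1 s / F 0 s * (?K x * c x s)"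
      proof (cases "x < N")
        case True
        have "F (Suc x) s * c x s * Psi I \<Phi> (G x s, G (Suc x) s - G x s)
            \<le> F (Suc x) s * c x s * (?K x / F x s)"
          using Psi_cmean_le[OF I True s(1) Psi_nonneg conv] Fx c_nonneg s
          by (intro mult_left_mono) (auto simp: G_def F_def \<psi>_def cmean_def)
        also have "\<dots> = F (Suc x) s / F x s * (?K x * c x s)" by simp
        \<comment> \<open>Every jump rate is replaced by the largest one, at state 0, which is the
          logarithmic derivative of \<open>F 0\<close>.\<close>
        also have "\<dots> \<le> F 1 s / F 0 s * (?K x * c x s)"
          using egf_ratio_le[of x s] True s K_nonneg c_nonneg
          by (intro mult_right_mono) (auto simp: F_def)
        finally show ?thesis .
      next
        case False
        with \<open>x \<in> {..N}\<close> have "x = N" by simp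
        then show ?thesis using Fx K_nonneg c_nonneg[of s] s by (simp add: F_last)
      qed
    qed
    also have "\<dots> = F 1 s / F 0 s * (\<Sum>x\<le>N. ?K x * (1 - s) ^ x / fact x)"
      by (simp add: sum_distrib_left c_def)
    \<comment> \<open>Tower property: averaging the conditional means of \<open>\<psi>\<close> over
      the law at \<open>s\<close> gives the same value \<open>B\<close> for every
      \<open>s\<close>.\<close>
    also have "(\<Sum>x\<le>N. ?K x * (1 - s) ^ x / fact x) = B"
      by (subst egf_taylor) (auto simp: zero B_def)
    finally show ?thesis .
  qed
  have "L 0 \<le> L 1"
  \<comment> \<open>The coupling requires \<open>s > 0\<close>, so the sign of the derivative is
    used only inside the interval; continuity covers the endpoints.\<close>
  proof (rule DERIV_nonneg_imp_increasing_open[where f = L])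
    show "continuous_on {0..1} L"
      by (rule DERIV_continuous_on) (rule L_deriv)
    fix s :: real assume s: "0 < s" "s < 1"
    have "at s within {0..1} = at s" using at_within_Icc_at[of 0 s 1] s by simp
    with L_deriv[of s] s
    have "(L has_real_derivative
      - (\<Sum>x\<le>N. F (Suc x) s * c x s * Psi I \<Phi> (G x s, G (Suc x) s - G x s)) + F 1 s / F 0 s * B) (at s)"
      by simp
    then show "\<exists>y. (L has_real_derivative y) (at s) \<and> 0 \<le> y"
      by - (rule exI, rule conjI, assumption, use dissipation_le[OF s] in simp)
  qed simp
  moreover have "E 0 = (\<Sum>k\<le>N. a k / fact k * \<Phi> (g k))"
    unfolding E_def
  proof (intro sum.cong refl)
    fix k assume "k \<in> {..N}"
    then have "a k \<noteq> 0" using pos[of k] by simp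
    then show "F k 0 * c k 0 * \<Phi> (G k 0) = a k / fact k * \<Phi> (g k)"
      by (simp add: F_def G_def c_def cmean_def egf_at_0)
  qed
  moreover have F1: "F 0 1 = 1"
    using prob by (simp add: F_def egf_def)
  moreover have "E 1 = \<Phi> (\<Sum>k\<le>N. a k / fact k * g k)"
  \<comment> \<open>At \<open>s = 1\<close> only the state 0 carries mass, as
    \<open>0 ^ 0 = 1\<close>.\<close>
  proof -
    have "E 1 = (\<Sum>x\<le>N. if x = 0 then F 0 1 * \<Phi> (G 0 1) else 0)"
      unfolding E_def by (intro sum.cong) (auto simp: c_def)
    also have "\<dots> = \<Phi> (G 0 1)" by (simp add: F1)
    also have "G 0 1 = (\<Sum>k\<le>N. a k / fact k * g k)"
      using F1 by (simp add: F_def G_def cmean_def) (simp add: egf_def)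
    finally show ?thesis .
  qed
  moreover have "F 0 0 = a 0" by (simp add: F_def egf_at_0)
  ultimately show ?thesis
    unfolding \<psi>_def[symmetric] B_def[symmetric] by (simp add: L_def)
qed

end

section \<open>Expectations as series, and truncation of the measure\<close>

lemma pmf_nat_sums_expectation:
  fixes \<mu> :: "nat pmf" and h :: "nat \<Rightarrow> real"
  assumes "integrable (measure_pmf \<mu>) h"
  shows "(\<lambda>k. pmf \<mu> k * h k) sums (\<integral>k. h k \<partial>measure_pmf \<mu>)"
proof -
  have "integrable (count_space UNIV) (\<lambda>k. pmf \<mu> k * h k)"
    using assms unfolding measure_pmf_eq_density by (subst (asm) integrable_density) auto
  moreover have "(\<integral>k. h k \<partial>measure_pmf \<mu>) = (\<integral>k. pmf \<mu> k * h k \<partial>count_space UNIV)"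
    unfolding measure_pmf_eq_density by (subst integral_density) auto
  ultimately show ?thesis by (simp add: sums_integral_count_space_nat)
qed

lemma pmf_nat_integrableI:
  fixes \<mu> :: "nat pmf" and h :: "nat \<Rightarrow> real"
  assumes "\<And>k. 0 \<le> h k" "summable (\<lambda>k. pmf \<mu> k * h k)"
  shows "integrable (measure_pmf \<mu>) h"
  unfolding measure_pmf_eq_density using assms
  by (subst integrable_density) (auto simp: integrable_count_space_nat_iff)

lemma ultra_log_concave_pmf_pos:
  assumes "ultra_log_concave \<mu>"
  shows "0 < pmf \<mu> k"
proof -
  obtain l f where "0 < l" "\<And>k. 0 < f k" "\<And>k. pmf \<mu> k = f k * pmf (poisson_pmf l) k"
    using assms unfolding ultra_log_concave_def by (auto simp del: pmf_poisson)
  then show ?thesis by simp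
qed

text \<open>\<open>entropy_le\<close> for the law conditioned on \<open>{..N}\<close>, multiplied by
  its mass \<open>M N\<close> so that partial sums of the full series appear.\<close>

lemma truncated_entropy_le:
  fixes \<mu> :: "nat pmf"
  assumes ulc: "ultra_log_concave \<mu>"
    and I: "is_interval I" "\<And>k. g k \<in> I"
    and deriv: "\<And>u. u \<in> I \<Longrightarrow> (\<Phi> has_real_derivative vector_derivative \<Phi> (at u within I)) (at u within I)"
    and Psi_nonneg: "\<And>p. p \<in> Psi_dom I \<Longrightarrow> 0 \<le> Psi I \<Phi> p"
    and conv: "convex_on (Psi_dom I) (Psi I \<Phi>)"
  defines "M \<equiv> \<lambda>N. \<Sum>k\<le>N. pmf \<mu> k"
  defines "m \<equiv> \<lambda>N. (\<Sum>k\<le>N. pmf \<mu> k * g k) / M N"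
  shows "m N \<in> I"
    and "(\<Sum>k\<le>N. pmf \<mu> k * \<Phi> (g k))
      \<le> M N * \<Phi> (m N) - ln (pmf \<mu> 0 / M N) * (\<Sum>k\<le>N. pmf \<mu> k * Psi I \<Phi> (g k, g (Suc k) - g k))"
proof -
  obtain l f where l: "0 < l" and f: "\<And>k. 0 < f k" "log_concave f"
    and mu: "\<And>k. pmf \<mu> k = f k * pmf (poisson_pmf l) k"
    using ulc unfolding ultra_log_concave_def by (auto simp del: pmf_poisson)
  \<comment> \<open>Multiplying by \<open>fact k\<close> cancels the Poisson factorial; what remains
    is \<open>f\<close> times a geometric sequence, which preserves log-concavity.\<close>
  define b where "b k = pmf \<mu> k * fact k" for k
  have b: "b k = f k * (l ^ k * exp (- l))" for k
    using l by (simp add: b_def mu)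
  have b_pos: "0 < b k" for k using l f by (simp add: b)
  note mu_pos = ultra_log_concave_pmf_pos[OF ulc]
  have "log_concave b"
    unfolding log_concave_def
  proof (intro allI impI)
    fix k :: nat assume "1 \<le> k"
    then obtain j where k: "k = Suc j" by (cases k) auto
    have "b (k - 1) * b (k + 1) = (l ^ k * exp (- l))\<^sup>2 * (f (k - 1) * f (k + 1))"
      by (simp add: b k power2_eq_square mult_ac)
    also have "\<dots> \<le> (l ^ k * exp (- l))\<^sup>2 * (f k)\<^sup>2"
      using f(2) \<open>1 \<le> k\<close> by (intro mult_left_mono) (auto simp: log_concave_def)
    finally show "b (k - 1) * b (k + 1) \<le> (b k)\<^sup>2"
      by (simp add: b power_mult_distrib mult_ac)
  qed
  note cross = log_concave_cross[OF b_pos this]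
  have M_pos: "0 < M N" unfolding M_def using mu_pos by (intro sum_pos) auto
  define a where "a k = (if k \<le> N then b k / M N else 0)" for k
  interpret log_concave_weights N a
  proof
    fix i j :: nat assume "i \<le> j"
    \<comment> \<open>Truncation is compatible with \<open>cross\<close>: if the left side is not
      cut off, then \<open>Suc j \<le> N\<close>, and all indices on the right are at most
      \<open>N\<close> too.\<close>
    from cross[OF this] show "a i * a (Suc j) \<le> a j * a (Suc i)"
      using M_pos \<open>i \<le> j\<close>
      by (auto simp: a_def intro!: divide_right_mono divide_nonneg_pos mult_nonneg_nonneg less_imp_le[OF b_pos])
  qed (auto simp: a_def M_pos b_pos)
  have sum_a: "(\<Sum>k\<le>N. a k / fact k * h k) = (\<Sum>k\<le>N. pmf \<mu> k * h k) / M N" for h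
    unfolding sum_divide_distrib by (intro sum.cong) (auto simp: a_def b_def)
  have prob: "(\<Sum>k\<le>N. a k / fact k) = 1"
    using sum_a[of "\<lambda>_. 1"] M_pos by (simp add: M_def)
  have "(\<Sum>k\<le>N. (a k / fact k) *\<^sub>R g k) \<in> I"
    by (rule convex_sum) (use I prob nonneg is_interval_convex in auto)
  then show "m N \<in> I"
    by (simp only: real_scaleR_def sum_a m_def)
  have "(\<Sum>k\<le>N. a k / fact k * \<Phi> (g k)) - \<Phi> (\<Sum>k\<le>N. a k / fact k * g k)
      \<le> - ln (a 0) * (\<Sum>k\<le>N. a k / fact k * Psi I \<Phi> (g k, g (Suc k) - g k))"
    by (rule entropy_le) (use I deriv Psi_nonneg conv prob in auto)
  then have "(\<Sum>k\<le>N. pmf \<mu> k * \<Phi> (g k)) / M N - \<Phi> (m N)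
      \<le> - ln (pmf \<mu> 0 / M N) * ((\<Sum>k\<le>N. pmf \<mu> k * Psi I \<Phi> (g k, g (Suc k) - g k)) / M N)"
    by (simp only: sum_a) (simp add: a_def b_def m_def)
  from mult_left_mono[OF this less_imp_le[OF M_pos]]
  show "(\<Sum>k\<le>N. pmf \<mu> k * \<Phi> (g k))
      \<le> M N * \<Phi> (m N) - ln (pmf \<mu> 0 / M N) * (\<Sum>k\<le>N. pmf \<mu> k * Psi I \<Phi> (g k, g (Suc k) - g k))"
    using M_pos by (simp add: right_diff_distrib)
qed

section \<open>Passage to the limit\<close>

theorem theorem1p7:
  fixes \<mu> :: "nat pmf" and I :: "real set" and \<Phi> :: "real \<Rightarrow> real" and g :: "nat \<Rightarrow> real"
  assumes "ultra_log_concave \<mu>"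
    and "is_interval I" and "closed I"
    and "smooth_on_interval I \<Phi>" and "convex_on I \<Phi>"
    and "\<forall>p\<in>Psi_dom I. Psi I \<Phi> p \<ge> 0"
    and "convex_on (Psi_dom I) (Psi I \<Phi>)"
    and "integrable (measure_pmf \<mu>) (\<lambda>k. (g k)\<^sup>2)"
    and "AE k in measure_pmf \<mu>. g k \<in> I \<and> g k + fdiff g k \<in> I"
  shows "Phi_entropy (measure_pmf \<mu>) \<Phi> g
    \<le> ereal \<bar>ln (pmf \<mu> 0)\<bar> * ext_integral (measure_pmf \<mu>) (\<lambda>k. Psi I \<Phi> (g k, fdiff g k))"
proof -
  note mu_pos = ultra_log_concave_pmf_pos[OF assms(1)]
  \<comment> \<open>All atoms have positive mass, so an almost sure property holds at every
    point.\<close>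
  then have g_in: "g k \<in> I" for k
    using assms(9) by (auto simp: AE_measure_pmf_iff set_pmf_iff less_imp_neq[symmetric])
  define \<psi> where "\<psi> k = Psi I \<Phi> (g k, fdiff g k)" for k
  have \<psi>_alt: "\<psi> k = Psi I \<Phi> (g k, g (Suc k) - g k)" for k
    by (simp add: \<psi>_def fdiff_def)
  have \<psi>_nonneg: "0 \<le> \<psi> k" for k
    unfolding \<psi>_alt using assms(6) g_in by (auto simp: Psi_dom_def)
  have deriv: "(\<Phi> has_real_derivative vector_derivative \<Phi> (at u within I)) (at u within I)" if "u \<in> I" for u
  proof -
    obtain d where d0: "\<And>x. x \<in> I \<Longrightarrow> d 0 x = \<Phi> x"
      and d: "\<And>n x. x \<in> I \<Longrightarrow> (d n has_real_derivative d (Suc n) x) (at x within I)"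
      using assms(4) unfolding smooth_on_interval_def by blast
    have "(\<Phi> has_real_derivative d (Suc 0) u) (at u within I)"
      using has_field_derivative_transform_within[OF d[OF that] zero_less_one that, of 0 \<Phi>] d0 by auto
    \<comment> \<open>\<open>vector_derivative\<close> chooses some derivative, so existence
      suffices; this covers a one-point \<open>I\<close>, where derivatives are not unique.\<close>
    then have "\<Phi> differentiable (at u within I)"
      using real_differentiable_def by blast
    then show ?thesis
      by (simp add: has_real_derivative_iff_has_vector_derivative vector_derivative_works)
  qed
  define M where "M N = (\<Sum>k\<le>N. pmf \<mu> k)" for N
  define m where "m N = (\<Sum>k\<le>N. pmf \<mu> k * g k) / M N" for N
  note trunc = truncated_entropy_le[where g = g, OF assms(1,2) g_in deriv bspec[OF assms(6)] assms(7),
      folded M_def, folded m_def \<psi>_alt]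
  have sums_lim: "(\<lambda>N. \<Sum>k\<le>N. pmf \<mu> k * h k) \<longlonglongrightarrow> (\<integral>k. h k \<partial>measure_pmf \<mu>)"
    if "integrable (measure_pmf \<mu>) h" for h :: "nat \<Rightarrow> real"
    using pmf_nat_sums_expectation[OF that] by (simp add: sums_def_le)
  have g_int: "integrable (measure_pmf \<mu>) g"
    by (rule measure_pmf.square_integrable_imp_integrable) (use assms(8) in auto)
  define mean where "mean = (\<integral>k. g k \<partial>measure_pmf \<mu>)"
  have M_lim: "M \<longlonglongrightarrow> 1"
    using sums_lim[of "\<lambda>_. 1"] by (simp add: M_def[abs_def])
  have m_lim: "m \<longlonglongrightarrow> mean"
    using tendsto_divide[OF sums_lim[OF g_int] M_lim] by (simp add: m_def[abs_def] mean_def)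
  have mean_in: "mean \<in> I"
    using closed_sequentially[OF assms(3) _ m_lim] trunc(1) by simp
  have Phi_m_lim: "(\<lambda>N. \<Phi> (m N)) \<longlonglongrightarrow> \<Phi> mean"
  proof -
    have "continuous_on I \<Phi>" using deriv by (rule DERIV_continuous_on)
    from continuous_on_tendsto_compose[OF this m_lim mean_in] trunc(1) show ?thesis by simp
  qed
  show ?thesis
  proof (cases "integrable (measure_pmf \<mu>) \<psi>")
    case False
    have "(\<integral>\<^sup>+k. ennreal (\<psi> k) \<partial>measure_pmf \<mu>) = \<infinity>"
      using False \<psi>_nonneg by (auto simp: integrable_iff_bounded not_less top_unique)
    moreover have "(\<integral>\<^sup>+k. ennreal (- \<psi> k) \<partial>measure_pmf \<mu>) = 0"
      using \<psi>_nonneg by (simp add: ennreal_neg)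
    ultimately have "ext_integral (measure_pmf \<mu>) \<psi> = \<infinity>"
      by (simp add: ext_integral_def)
    \<comment> \<open>The logarithm must be nonzero for the right side to be infinite, since
      \<open>0 * \<infinity> = 0\<close> in \<open>ereal\<close>.\<close>
    moreover have "pmf \<mu> 0 < 1"
    proof -
      have "pmf \<mu> 0 + pmf \<mu> 1 \<le> 1"
        using measure_pmf.prob_le_1[of \<mu> "{0, 1}"] by (simp add: measure_measure_pmf_finite)
      then show ?thesis using mu_pos[of 1] by simp
    qed
    ultimately show ?thesis
      using mu_pos[of 0] by (simp add: \<psi>_def[abs_def])
  next
    case True
    define R where "R N = M N * \<Phi> (m N) - ln (pmf \<mu> 0 / M N) * (\<Sum>k\<le>N. pmf \<mu> k * \<psi> k)" for N
    let ?B = "\<integral>k. \<psi> k \<partial>measure_pmf \<mu>"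
    have R_lim: "R \<longlonglongrightarrow> \<Phi> mean - ln (pmf \<mu> 0) * ?B"
    proof -
      have "R \<longlonglongrightarrow> 1 * \<Phi> mean - ln (pmf \<mu> 0 / 1) * ?B"
        unfolding R_def[abs_def] using mu_pos[of 0]
        by (intro tendsto_intros M_lim Phi_m_lim sums_lim True) auto
      then show ?thesis by simp
    qed
    \<comment> \<open>An affine minorant of \<open>\<Phi>\<close> along \<open>g\<close>: it turns the upper bound on the partial sums into
      integrability of \<open>\<Phi> \<circ> g\<close>.\<close>
    define A where "A k = \<Phi> mean + vector_derivative \<Phi> (at mean within I) * (g k - mean)" for k
    have A_int: "integrable (measure_pmf \<mu>) A"
      unfolding A_def[abs_def] using g_int by simp
    have A_le: "0 \<le> \<Phi> (g k) - A k" for k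
    proof -
      \<comment> \<open>This value of \<open>Psi\<close> is the gap between \<open>\<Phi>\<close>
        and its tangent at \<open>mean\<close>.\<close>
      have "0 \<le> Psi I \<Phi> (mean, g k - mean)"
        using assms(6) mean_in g_in by (auto simp: Psi_dom_def)
      then show ?thesis by (simp add: Psi_def A_def)
    qed
    have "Bseq (\<lambda>N. R N - (\<Sum>k\<le>N. pmf \<mu> k * A k))"
      by (rule convergent_imp_Bseq, rule convergentI, rule tendsto_diff[OF R_lim sums_lim[OF A_int]])
    then obtain C where C: "\<And>N. \<bar>R N - (\<Sum>k\<le>N. pmf \<mu> k * A k)\<bar> \<le> C"
      unfolding Bseq_def by auto
    have "summable (\<lambda>k. pmf \<mu> k * (\<Phi> (g k) - A k))"
    proof (rule bounded_imp_summable)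
      show "(\<Sum>k\<le>N. pmf \<mu> k * (\<Phi> (g k) - A k)) \<le> C" for N
        using C[of N] trunc(2)[of N] by (simp add: R_def right_diff_distrib sum_subtractf)
      show "0 \<le> pmf \<mu> k * (\<Phi> (g k) - A k)" for k using A_le by simp
    qed
    then have "integrable (measure_pmf \<mu>) (\<lambda>k. \<Phi> (g k) - A k)"
      by (intro pmf_nat_integrableI A_le)
    from Bochner_Integration.integrable_add[OF this A_int]
    have Phi_int: "integrable (measure_pmf \<mu>) (\<lambda>k. \<Phi> (g k))" by simp
    have "(\<integral>k. \<Phi> (g k) \<partial>measure_pmf \<mu>) \<le> \<Phi> mean - ln (pmf \<mu> 0) * ?B"
      by (rule LIMSEQ_le[OF sums_lim[OF Phi_int] R_lim]) (use trunc(2) in \<open>auto simp: R_def\<close>)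
    moreover have "\<bar>ln (pmf \<mu> 0)\<bar> = - ln (pmf \<mu> 0)"
      using mu_pos[of 0] pmf_le_1[of \<mu> 0] by simp
    ultimately show ?thesis
      using ext_integral_eq_lebesgue_integral[OF True] ext_integral_eq_lebesgue_integral[OF Phi_int]
      by (simp add: Phi_entropy_def mean_def \<psi>_def[abs_def])
  qed
qed

end
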